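(* For parameters $\alpha=(\alpha_1,\alpha_2,\alpha_3)$ in the parameter space $\mathcal N\subset\mathbb{R}^3$, the matrix $$\mathbf{A}_0(\alpha)=\begin{pmatrix}0&1&0&0\\ \alpha_1&\alpha_2&0&0\\0&0&\alpha_3&-1\\0&0&1&\alpha_3\end{pmatrix}$$ has the four eigenvalues $$\lambda_{1,2}=\frac{\alpha_2}{2}\pm\sqrt{\alpha_1+\Bigl(\frac{\alpha_2}{2}\Bigr)^2},\qquad \lambda_{3,4}=\alpha_3\pm i .$$ All four eigenvalues have negative real part if and only if $\alpha_j<0$, $j=1,2,3$. Therefore the trivial equilibrium solution of the normal form system whose linear part is $\mathbf{A}_0(\alpha)$ is asymptotically stable strictly inside the negative octant of the parameter space $\mathcal N$.
   Context: $\mathcal N$ is a neighbourhood of the origin in $\mathbb{R}^3$. The normal form system, with $y_1,y_2\in\mathbb{R}$ and $z\in\mathbb{C}$, is $$\dot y_1=y_2,\quad \dot y_2=[\alpha_1+\phi_1]y_1+[\alpha_2+\phi_2]y_2,\quad \dot z=[i+\alpha_3+\phi_3+i\phi_4]z,$$ where $\phi_j=\phi_j(y_1^2,z\bar z)$, $j=1,\dots,4$, are real-valued formal power series (which may not converge) in $y_1^2$ and $z\bar z$ with $\phi_j(0,0)=0$. Its linear part, written in real coordinates, is $\mathbf{A}_0(\alpha)$, and the stability of the trivial equilibrium $(y_1,y_2,z)=(0,0,0)$ is determined by the eigenvalues of this linear part. *)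

theory Defs
  imports "HOL-Analysis.Analysis" "Jordan_Normal_Form.Char_Poly"
begin

section \<open>The linear part\<close>

definition A0 :: "real \<Rightarrow> real \<Rightarrow> real \<Rightarrow> real mat" where
  "A0 \<alpha>1 \<alpha>2 \<alpha>3 = mat_of_rows_list 4
     [[ 0,  1,  0,  0],
      [\<alpha>1, \<alpha>2,  0,  0],
      [ 0,  0, \<alpha>3, -1],
      [ 0,  0,  1, \<alpha>3]]"

abbreviation A0_complex :: "real \<Rightarrow> real \<Rightarrow> real \<Rightarrow> complex mat" where
  "A0_complex \<alpha>1 \<alpha>2 \<alpha>3 \<equiv> map_mat complex_of_real (A0 \<alpha>1 \<alpha>2 \<alpha>3)"

text \<open>The square root is complex: its argument may be negative.\<close>

definition lambda1 :: "real \<Rightarrow> real \<Rightarrow> complex" where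
  "lambda1 \<alpha>1 \<alpha>2 = complex_of_real (\<alpha>2 / 2) + csqrt (complex_of_real (\<alpha>1 + (\<alpha>2 / 2)\<^sup>2))"

definition lambda2 :: "real \<Rightarrow> real \<Rightarrow> complex" where
  "lambda2 \<alpha>1 \<alpha>2 = complex_of_real (\<alpha>2 / 2) - csqrt (complex_of_real (\<alpha>1 + (\<alpha>2 / 2)\<^sup>2))"

definition lambda3 :: "real \<Rightarrow> complex" where
  "lambda3 \<alpha>3 = complex_of_real \<alpha>3 + \<i>"

definition lambda4 :: "real \<Rightarrow> complex" where
  "lambda4 \<alpha>3 = complex_of_real \<alpha>3 - \<i>"

section \<open>Asymptotic stability of an equilibrium\<close>

definition solves_on :: "('a::real_normed_vector \<Rightarrow> 'a) \<Rightarrow> (real \<Rightarrow> 'a) \<Rightarrow> real set \<Rightarrow> bool" where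
  "solves_on F x I \<longleftrightarrow> (\<forall>t\<in>I. (x has_vector_derivative F (x t)) (at t within I))"

text \<open>Lyapunov stability. The first clause (solutions starting near \<open>e\<close> exist for all
  \<open>t \<ge> 0\<close>) is part of the notion; the second one is about every solution on every
  compact time interval, so that no uniqueness of solutions is presupposed.\<close>

definition stable_equilibrium :: "('a::real_normed_vector \<Rightarrow> 'a) \<Rightarrow> 'a \<Rightarrow> bool" where
  "stable_equilibrium F e \<longleftrightarrow> F e = 0 \<and>
     (\<forall>\<epsilon>>0. \<exists>\<delta>>0. \<forall>p\<in>ball e \<delta>.
        (\<exists>x. solves_on F x {0..} \<and> x 0 = p) \<and>
        (\<forall>T\<ge>0. \<forall>x. solves_on F x {0..T} \<and> x 0 = p \<longrightarrow> (\<forall>t\<in>{0..T}. x t \<in> ball e \<epsilon>)))"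

definition attractive_equilibrium :: "('a::real_normed_vector \<Rightarrow> 'a) \<Rightarrow> 'a \<Rightarrow> bool" where
  "attractive_equilibrium F e \<longleftrightarrow> F e = 0 \<and>
     (\<exists>\<delta>>0. \<forall>x. solves_on F x {0..} \<and> x 0 \<in> ball e \<delta> \<longrightarrow> (x \<longlongrightarrow> e) at_top)"

definition asymptotically_stable :: "('a::real_normed_vector \<Rightarrow> 'a) \<Rightarrow> 'a \<Rightarrow> bool" where
  "asymptotically_stable F e \<longleftrightarrow> stable_equilibrium F e \<and> attractive_equilibrium F e"

section \<open>The normal form system\<close>

text \<open>A formal power series in two variables \<open>u\<close>, \<open>v\<close> is an element of
  \<^typ>\<open>real fps fps\<close>, with \<open>u\<close> the outer and \<open>v\<close> the inner variable; the following
  is the coefficient of \<open>u\<^sup>i v\<^sup>j\<close>.\<close>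

definition coeff2 :: "real fps fps \<Rightarrow> nat \<Rightarrow> nat \<Rightarrow> real" where
  "coeff2 f i j = fps_nth (fps_nth f i) j"

text \<open>A formal power series need not converge, so it defines a vector field only through
  functions having it as Taylor series: \<open>\<phi>\<close> is of class \<open>C\<^sup>\<infinity>\<close> near the origin, and its
  Taylor series there is \<open>f\<close>. Here \<open>D i j\<close> is the partial derivative of \<open>\<phi>\<close> of order
  \<open>i\<close> in \<open>u\<close> and \<open>j\<close> in \<open>v\<close>. By Borel's lemma every \<open>f\<close> has such a \<open>\<phi>\<close>.\<close>

definition smooth_with_taylor_series :: "(real \<times> real \<Rightarrow> real) \<Rightarrow> real fps fps \<Rightarrow> bool" where
  "smooth_with_taylor_series \<phi> f \<longleftrightarrow>
     (\<exists>U D. open U \<and> (0, 0) \<in> U \<and> (\<forall>p\<in>U. D 0 0 p = \<phi> p) \<and>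
        (\<forall>i j. \<forall>p\<in>U. (D i j has_derivative
           (\<lambda>(h, k). h * D (Suc i) j p + k * D i (Suc j) p)) (at p)) \<and>
        (\<forall>i j. D i j (0, 0) = fact i * fact j * coeff2 f i j))"

definition normal_form_field ::
  "real \<Rightarrow> real \<Rightarrow> real \<Rightarrow> (nat \<Rightarrow> real \<times> real \<Rightarrow> real) \<Rightarrow>
   real \<times> real \<times> complex \<Rightarrow> real \<times> real \<times> complex" where
  "normal_form_field \<alpha>1 \<alpha>2 \<alpha>3 \<phi> = (\<lambda>(y1, y2, z).
     let w = (y1\<^sup>2, Re (z * cnj z)) in
     (y2,
      (\<alpha>1 + \<phi> 1 w) * y1 + (\<alpha>2 + \<phi> 2 w) * y2,
      (\<i> + complex_of_real \<alpha>3 + complex_of_real (\<phi> 3 w) + \<i> * complex_of_real (\<phi> 4 w)) * z))"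

definition real_coords :: "real \<times> real \<times> complex \<Rightarrow> real vec" where
  "real_coords = (\<lambda>(y1, y2, z). vec_of_list [y1, y2, Re z, Im z])"

end

theory Submission
  imports Defs "HOL-Real_Asymp.Real_Asymp"
begin

text \<open>The matrix is block diagonal, so its characteristic polynomial is a product of two
  quadratics. For stability put \<open>a = - \<alpha>1\<close>, \<open>b = - \<alpha>2\<close> and
  \<open>V = 2a y1\<^sup>2 + y2\<^sup>2 + (b y1 + y2)\<^sup>2 + |z|\<^sup>2\<close>. Along the linear system
  \<open>V\<close> has derivative \<open>- 2ab y1\<^sup>2 - 2b y2\<^sup>2 + 2\<alpha>3 |z|\<^sup>2\<close>; since the functions
  \<open>\<phi> j\<close> vanish and are continuous at the origin, \<open>V' \<le> - c V\<close> survives in a small ball, which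
  traps solutions and makes them decay exponentially. Solutions exist for all time because the field
  is Lipschitz near the origin: cut off outside the ball, it is globally Lipschitz, and the
  solutions of the cut-off equation that start near the origin never leave the ball.\<close>

section \<open>The eigenvalues of the linear part\<close>

lemma det_mat_2:
  fixes A :: "'a::comm_ring_1 mat"
  assumes A: "A \<in> carrier_mat 2 2"
  shows "det A = A $$ (0,0) * A $$ (1,1) - A $$ (0,1) * A $$ (1,0)"
  using A
  by (subst laplace_expansion_column[OF A, of 0])
    (simp_all add: numeral_2_eq_2 cofactor_def mat_delete_def det_single)

lemma char_poly_A0_complex:
  "char_poly (A0_complex \<alpha>1 \<alpha>2 \<alpha>3) =
    [:- of_real \<alpha>1, - of_real \<alpha>2, 1:] * [:(of_real \<alpha>3)\<^sup>2 + 1, - 2 * of_real \<alpha>3, 1:]"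
proof -
  \<comment> \<open>\<open>B\<close> and \<open>C\<close> are the diagonal blocks of X I - A for A =
    \<open>A0_complex\<close>, with \<open>[:0, 1:]\<close> as the indeterminate X.\<close>
  define B :: "complex poly mat" where
    "B = mat_of_rows_list 2 [[ [:0, 1:], -1], [[:- of_real \<alpha>1:], [:- of_real \<alpha>2, 1:]]]"
  define C :: "complex poly mat" where
    "C = mat_of_rows_list 2 [[ [:- of_real \<alpha>3, 1:], 1], [-1, [:- of_real \<alpha>3, 1:]]]"
  have carrier: "B \<in> carrier_mat 2 2" "C \<in> carrier_mat 2 2"
    by (auto simp: B_def C_def mat_of_rows_list_def)
  have "char_poly_matrix (A0_complex \<alpha>1 \<alpha>2 \<alpha>3) = four_block_mat B (0\<^sub>m 2 2) (0\<^sub>m 2 2) C"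
    unfolding B_def C_def
    by (rule eq_matI) (auto simp: char_poly_matrix_def A0_def mat_of_rows_list_def
        numeral_eq_Suc less_Suc_eq one_pCons)
  then have "char_poly (A0_complex \<alpha>1 \<alpha>2 \<alpha>3) = det B * det C"
    unfolding char_poly_def
    using det_four_block_mat_lower_left_zero[OF carrier(1) zero_carrier_mat refl carrier(2)] by simp
  moreover have "det B = [:- of_real \<alpha>1, - of_real \<alpha>2, 1:]"
    unfolding det_mat_2[OF carrier(1)] by (simp add: B_def mat_of_rows_list_def one_pCons)
  moreover have "det C = [:(of_real \<alpha>3)\<^sup>2 + 1, - 2 * of_real \<alpha>3, 1:]"
    unfolding det_mat_2[OF carrier(2)]
    by (simp add: C_def mat_of_rows_list_def one_pCons power2_eq_square)
  ultimately show ?thesis by simp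
qed

text \<open>Vieta's formulas: the roots \<alpha>2 / 2 + s and \<alpha>2 / 2 - s have sum \<alpha>2
  and product \<alpha>2^2 / 4 - s^2 = - \<alpha>1. They are exchanged by the sign of s, so the
  square of s is all that enters, whichever branch \<open>csqrt\<close> picks.\<close>

lemma char_poly_A0_complex_factored:
  "char_poly (A0_complex \<alpha>1 \<alpha>2 \<alpha>3) =
    (\<Prod>l\<leftarrow>[lambda1 \<alpha>1 \<alpha>2, lambda2 \<alpha>1 \<alpha>2, lambda3 \<alpha>3, lambda4 \<alpha>3]. [:-l, 1:])"
proof -
  define s where "s = csqrt (complex_of_real (\<alpha>1 + (\<alpha>2 / 2)\<^sup>2))"
  have "s\<^sup>2 = complex_of_real (\<alpha>1 + (\<alpha>2 / 2)\<^sup>2)"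
    unfolding s_def by (rule power2_csqrt)
  then have s: "s * s = of_real \<alpha>1 + (of_real \<alpha>2)\<^sup>2 / 4"
    by (simp add: power2_eq_square)
  have lambda: "lambda1 \<alpha>1 \<alpha>2 = of_real \<alpha>2 / 2 + s" "lambda2 \<alpha>1 \<alpha>2 = of_real \<alpha>2 / 2 - s"
    by (simp_all add: lambda1_def lambda2_def s_def)
  have product: "lambda1 \<alpha>1 \<alpha>2 * lambda2 \<alpha>1 \<alpha>2 = - of_real \<alpha>1"
    unfolding lambda using s by (simp add: algebra_simps power2_eq_square)
  have sum: "lambda1 \<alpha>1 \<alpha>2 + lambda2 \<alpha>1 \<alpha>2 = of_real \<alpha>2"
    by (simp add: lambda)
  have "[:- lambda1 \<alpha>1 \<alpha>2, 1:] * [:- lambda2 \<alpha>1 \<alpha>2, 1:] =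
      [:lambda1 \<alpha>1 \<alpha>2 * lambda2 \<alpha>1 \<alpha>2, - (lambda1 \<alpha>1 \<alpha>2 + lambda2 \<alpha>1 \<alpha>2), 1:]"
    by simp
  then have "[:- of_real \<alpha>1, - of_real \<alpha>2, 1:] =
      [:- lambda1 \<alpha>1 \<alpha>2, 1:] * [:- lambda2 \<alpha>1 \<alpha>2, 1:]"
    unfolding product sum by (rule sym)
  moreover have "[:(of_real \<alpha>3)\<^sup>2 + 1, - 2 * of_real \<alpha>3, 1:] = [:- lambda3 \<alpha>3, 1:] * [:- lambda4 \<alpha>3, 1:]"
    by (simp add: lambda3_def lambda4_def algebra_simps power2_eq_square)
  ultimately show ?thesis
    unfolding char_poly_A0_complex by (simp only: list.map prod_list.Cons prod_list.Nil mult_1_right mult.assoc)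
qed

lemma eigenvalue_A0_complex_iff:
  "eigenvalue (A0_complex \<alpha>1 \<alpha>2 \<alpha>3) l \<longleftrightarrow>
    l \<in> {lambda1 \<alpha>1 \<alpha>2, lambda2 \<alpha>1 \<alpha>2, lambda3 \<alpha>3, lambda4 \<alpha>3}"
proof -
  have "A0_complex \<alpha>1 \<alpha>2 \<alpha>3 \<in> carrier_mat 4 4"
    by (auto simp: A0_def mat_of_rows_list_def)
  moreover have "poly [:- a, 1:] l = 0 \<longleftrightarrow> l = a" for a :: complex
    by (auto simp: neg_eq_iff_add_eq_0)
  ultimately show ?thesis
    by (simp only: eigenvalue_root_char_poly char_poly_A0_complex_factored list.map
        prod_list.Cons prod_list.Nil mult_1_right poly_mult mult_eq_0_iff insert_iff empty_iff simp_thms)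
qed

text \<open>The sign of the radicand decides the case. If it is nonnegative, both roots are real and
  the larger one is negative exactly when the square root stays below - \<alpha>2 / 2. If it is
  negative, the square root is purely imaginary, both real parts are \<alpha>2 / 2, and the sign of
  the radicand already forces \<alpha>1 < 0.\<close>

lemma Re_lambda12_neg_iff:
  "Re (lambda1 \<alpha>1 \<alpha>2) < 0 \<and> Re (lambda2 \<alpha>1 \<alpha>2) < 0 \<longleftrightarrow> \<alpha>1 < 0 \<and> \<alpha>2 < 0"
proof (cases "\<alpha>1 + (\<alpha>2 / 2)\<^sup>2 \<ge> 0")
  case True
  then have Re: "Re (lambda1 \<alpha>1 \<alpha>2) = \<alpha>2 / 2 + sqrt (\<alpha>1 + (\<alpha>2 / 2)\<^sup>2)"
    "Re (lambda2 \<alpha>1 \<alpha>2) = \<alpha>2 / 2 - sqrt (\<alpha>1 + (\<alpha>2 / 2)\<^sup>2)"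
    by (auto simp: lambda1_def lambda2_def simp flip: of_real_sqrt)
  have "sqrt (\<alpha>1 + (\<alpha>2 / 2)\<^sup>2) \<ge> 0" using True by simp
  \<comment> \<open>For negative \<alpha>2 the right-hand side is the square root of its own square,
    so monotonicity of \<open>sqrt\<close> compares the radicands, which differ by
    \<alpha>1.\<close>
  moreover have "sqrt (\<alpha>1 + (\<alpha>2 / 2)\<^sup>2) < - (\<alpha>2 / 2) \<longleftrightarrow> \<alpha>1 < 0" if "\<alpha>2 < 0"
    using that real_sqrt_less_iff[of "\<alpha>1 + (\<alpha>2 / 2)\<^sup>2" "(\<alpha>2 / 2)\<^sup>2"] by (simp add: real_sqrt_abs)
  ultimately show ?thesis unfolding Re by (smt (verit) divide_less_0_iff)
next
  case False
  then have "Re (csqrt (complex_of_real (\<alpha>1 + (\<alpha>2 / 2)\<^sup>2))) = 0"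
    unfolding csqrt_of_real' by simp
  then have "Re (lambda1 \<alpha>1 \<alpha>2) = \<alpha>2 / 2" "Re (lambda2 \<alpha>1 \<alpha>2) = \<alpha>2 / 2"
    unfolding lambda1_def lambda2_def by simp_all
  moreover have "\<alpha>1 < 0" using False zero_le_power2[of "\<alpha>2 / 2"] by linarith
  ultimately show ?thesis by auto
qed

section \<open>Global solutions of Lipschitz differential equations\<close>

primrec picard_iterate ::
    "('a::banach \<Rightarrow> 'a) \<Rightarrow> 'a \<Rightarrow> nat \<Rightarrow> real \<Rightarrow> 'a" where
  "picard_iterate F p 0 = (\<lambda>t. p)"
| "picard_iterate F p (Suc n) = (\<lambda>t. p + integral {0..t} (\<lambda>s. F (picard_iterate F p n s)))"

lemma continuous_on_picard_iterate:
  fixes F :: "'a::banach \<Rightarrow> 'a"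
  assumes "continuous_on UNIV F"
  shows "continuous_on {0..T} (picard_iterate F p n)"
proof (induction n)
  case (Suc n)
  have "continuous_on {0..T} (\<lambda>s. F (picard_iterate F p n s))"
    by (rule continuous_on_compose2[OF assms Suc]) auto
  then show ?case
    by (auto intro!: continuous_intros indefinite_integral_continuous_1 integrable_continuous_real)
qed simp

text \<open>In the norm weighted by \<open>exp (- 2 K t)\<close> the Picard operator contracts by \<open>1 / 2\<close> on
  all of \<open>[0, \<infinity>)\<close>, so no gluing of local solutions is needed.\<close>

lemma norm_picard_iterate_diff_le:
  fixes F :: "'a::banach \<Rightarrow> 'a"
  assumes lip: "K-lipschitz_on UNIV F" and "K > 0" and "t \<ge> 0"
  shows "norm (picard_iterate F p (Suc n) t - picard_iterate F p n t)
    \<le> norm (F p) / K * exp (2 * K * t) / 2 ^ n"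
  using \<open>t \<ge> 0\<close>
proof (induction n arbitrary: t)
  case 0
  \<comment> \<open>The first increment has norm t * norm (F p); the exponential absorbs the factor
    t at the price of 1 / K.\<close>
  have "K * t \<le> exp (K * t)" "exp (K * t) \<le> exp (2 * K * t)"
    using exp_ge_add_one_self[of "K * t"] \<open>K > 0\<close> 0 by (linarith, simp)
  then have "K * t \<le> exp (2 * K * t)" by linarith
  then have "t \<le> exp (2 * K * t) / K"
    using \<open>K > 0\<close> by (subst pos_le_divide_eq) (auto simp: mult.commute)
  then have "t * norm (F p) \<le> exp (2 * K * t) / K * norm (F p)"
    by (rule mult_right_mono) simp
  then show ?case using 0 by (simp add: mult_ac)
next
  case (Suc n)
  define M where "M = norm (F p) / K / 2 ^ n"
  let ?x = "picard_iterate F p"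
  have contF: "continuous_on UNIV F"
    using lip by (rule lipschitz_on_continuous_on)
  have cont: "continuous_on {0..t} (\<lambda>s. F (?x m s))" for m
    by (rule continuous_on_compose2[OF contF continuous_on_picard_iterate[OF contF]]) auto
  \<comment> \<open>Integrating the weight \<open>exp (2 * K * s)\<close> divides by 2 K and the
    Lipschitz estimate multiplies by K: this is the factor 1 / 2 gained at each iteration.\<close>
  have int: "((\<lambda>s. K * (M * exp (2 * K * s))) has_integral
      M / 2 * exp (2 * K * t) - M / 2 * exp (2 * K * 0)) {0..t}"
    using \<open>K > 0\<close> Suc.prems
    by (intro fundamental_theorem_of_calculus)
      (auto simp flip: has_real_derivative_iff_has_vector_derivative intro!: derivative_eq_intros)
  have "norm (?x (Suc (Suc n)) t - ?x (Suc n) t)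
      = norm (integral {0..t} (\<lambda>s. F (?x (Suc n) s) - F (?x n s)))"
    using cont[of "Suc n"] cont[of n]
    by (subst integral_diff) (auto intro!: integrable_continuous_real)
  also have "\<dots> \<le> integral {0..t} (\<lambda>s. K * (M * exp (2 * K * s)))"
  proof (rule integral_norm_bound_integral)
    show "(\<lambda>s. F (?x (Suc n) s) - F (?x n s)) integrable_on {0..t}"
      using cont[of "Suc n"] cont[of n]
      by (intro integrable_continuous_real continuous_on_diff)
    fix s assume "s \<in> {0..t}"
    then have "norm (F (?x (Suc n) s) - F (?x n s)) \<le> K * norm (?x (Suc n) s - ?x n s)"
      "norm (?x (Suc n) s - ?x n s) \<le> M * exp (2 * K * s)"
      using lipschitz_on_normD[OF lip] Suc.IH[of s] by (auto simp: M_def)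
    then show "norm (F (?x (Suc n) s) - F (?x n s)) \<le> K * (M * exp (2 * K * s))"
      using \<open>K > 0\<close> by (meson mult_left_mono order_trans less_imp_le)
  qed (use int in blast)
  also have "\<dots> = M / 2 * exp (2 * K * t) - M / 2"
    using integral_unique[OF int] by simp
  also have "\<dots> \<le> norm (F p) / K * exp (2 * K * t) / 2 ^ Suc n"
    using \<open>K > 0\<close> by (simp add: M_def algebra_simps)
  finally show ?case .
qed

text \<open>The Picard iterates are partial sums of a telescoping series that converges uniformly on
  each [0, T] by the Weierstrass test. The limit satisfies the integral equation, and
  differentiating that equation gives the solution.\<close>

lemma lipschitz_global_solution_exists:
  fixes F :: "'a::banach \<Rightarrow> 'a"
  assumes "K-lipschitz_on UNIV F"
  shows "\<exists>x. solves_on F x {0..} \<and> x 0 = p"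
proof -
  \<comment> \<open>A Lipschitz constant may be 0, whereas the bound on the iterates divides by
    it.\<close>
  define L where "L = K + 1"
  have "L > 0" using lipschitz_on_nonneg[OF assms] by (simp add: L_def)
  have lip: "L-lipschitz_on UNIV F"
    using assms by (rule lipschitz_on_mono) (auto simp: L_def)
  have contF: "continuous_on UNIV F"
    using lip by (rule lipschitz_on_continuous_on)
  let ?x = "picard_iterate F p"
  define x where "x t = p + (\<Sum>n. ?x (Suc n) t - ?x n t)" for t
  have lim: "uniform_limit {0..T} ?x x sequentially" for T
  proof -
    define M where "M n = norm (F p) / L * exp (2 * L * T) * (1 / 2) ^ n" for n
    have "uniform_limit {0..T} (\<lambda>n t. \<Sum>k<n. ?x (Suc k) t - ?x k t)
        (\<lambda>t. \<Sum>n. ?x (Suc n) t - ?x n t) sequentially"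
    proof (rule Weierstrass_m_test)
      fix n t assume t: "t \<in> {0..T}"
      have "norm (?x (Suc n) t - ?x n t) \<le> norm (F p) / L * exp (2 * L * t) / 2 ^ n"
        using norm_picard_iterate_diff_le[OF lip \<open>L > 0\<close>] t by auto
      also have "\<dots> \<le> norm (F p) / L * exp (2 * L * T) / 2 ^ n"
        using t \<open>L > 0\<close> by (intro divide_right_mono mult_left_mono) auto
      finally show "norm (?x (Suc n) t - ?x n t) \<le> M n"
        by (simp add: M_def power_divide)
    qed (auto simp: M_def intro!: summable_mult summable_geometric)
    then have "uniform_limit {0..T} (\<lambda>n t. p + (\<Sum>k<n. ?x (Suc k) t - ?x k t)) x sequentially"
      unfolding x_def by (intro uniform_limit_intros)
    moreover have "p + (\<Sum>k<n. ?x (Suc k) t - ?x k t) = ?x n t" for n t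
      using sum_lessThan_telescope[of "\<lambda>k. ?x k t" n] by simp
    ultimately show ?thesis by simp
  qed
  have contx: "continuous_on {0..T} x" for T
    by (rule uniform_limit_theorem[OF _ lim])
      (auto intro!: always_eventually continuous_on_picard_iterate contF)
  have contFx: "continuous_on {0..T} (\<lambda>s. F (x s))" for T
    by (rule continuous_on_compose2[OF contF contx]) auto
  have x_eq: "x t = p + integral {0..t} (\<lambda>s. F (x s))" if "t \<ge> 0" for t
  proof -
    \<comment> \<open>A Lipschitz map is uniformly continuous, so the uniform limit passes through F
      and then through the integral.\<close>
    have "uniform_limit {0..t} (\<lambda>n s. F (?x n s)) (\<lambda>s. F (x s)) sequentially"
      using lipschitz_on_uniformly_continuous[OF lip]
      by (rule uniform_limit_compose_uniformly_continuous_on[OF lim]) auto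
    moreover have "continuous_on {0..t} (\<lambda>s. F (?x n s))" for n
      by (rule continuous_on_compose2[OF contF continuous_on_picard_iterate[OF contF]]) auto
    ultimately obtain I J where IJ: "\<And>n. ((\<lambda>s. F (?x n s)) has_integral I n) {0..t}"
      "((\<lambda>s. F (x s)) has_integral J) {0..t}" "I \<longlonglongrightarrow> J"
      by (rule uniform_limit_integral) auto
    have "(\<lambda>n. p + I n) \<longlonglongrightarrow> p + J" by (intro tendsto_intros IJ)
    moreover have "p + I n = ?x (Suc n) t" for n
      using integral_unique[OF IJ(1)[of n]] by simp
    moreover have "(\<lambda>n. ?x (Suc n) t) \<longlonglongrightarrow> x t"
      using tendsto_uniform_limitI[OF lim[of t], of t] that by (intro LIMSEQ_Suc) auto
    ultimately show ?thesis
      using LIMSEQ_unique integral_unique[OF IJ(2)] by auto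
  qed
  have "(x has_vector_derivative F (x t)) (at t within {0..})" if "t \<ge> 0" for t
  proof -
    \<comment> \<open>Ending the interval at \<open>t + 1\<close> keeps t away from the right
      endpoint, so that near t it agrees with \<open>{0..}\<close>; at t = 0 both derivatives are
      one-sided.\<close>
    have "((\<lambda>u. p + integral {0..u} (\<lambda>s. F (x s))) has_vector_derivative F (x t))
        (at t within {0..t + 1})"
      using integral_has_vector_derivative[OF contFx[of "t + 1"], of t] that
      by (auto intro!: derivative_eq_intros)
    then have "(x has_vector_derivative F (x t)) (at t within {0..t + 1})"
      by (rule has_vector_derivative_transform[rotated 2]) (use that x_eq in auto)
    moreover have "at t within {0..t + 1} = at t within {0..}"
      by (rule at_within_nhd[of t "{..<t + 1}"]) auto
    ultimately show ?thesis by simp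
  qed
  moreover have "x 0 = p" using x_eq[of 0] by simp
  ultimately show ?thesis unfolding solves_on_def by auto
qed

section \<open>Strict Lyapunov functions\<close>

lemma solves_on_subset:
  assumes "solves_on F x I" "J \<subseteq> I"
  shows "solves_on F x J"
  using assms unfolding solves_on_def
  by (meson has_vector_derivative_within_subset subsetD)

lemma continuous_on_solution:
  assumes "solves_on F x I"
  shows "continuous_on I x"
  using assms unfolding solves_on_def
  by (meson continuous_on_vector_derivative)

text \<open>A Gronwall argument: the product of V (x t) and exp (c t) has derivative (V' + c V) exp
  (c t), which is not positive, so the product cannot increase.\<close>

lemma lyapunov_decay:
  fixes V :: "'a::real_normed_vector \<Rightarrow> real"
  assumes sol: "solves_on F x {0..T}" and "T \<ge> 0"
    and V: "\<And>p. (V has_derivative V' p) (at p)"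
    and decr: "\<And>t. t \<in> {0..T} \<Longrightarrow> V' (x t) (F (x t)) \<le> - c * V (x t)"
  shows "V (x T) \<le> V (x 0) * exp (- c * T)"
proof -
  have contV: "continuous_on UNIV V"
    using V by (meson continuous_at_imp_continuous_on has_derivative_continuous)
  have "V (x T) * exp (c * T) \<le> V (x 0) * exp (c * 0)"
  \<comment> \<open>At interior times the derivative within the interval is two-sided, as the chain
    rule for real functions wants; continuity takes care of the endpoints.\<close>
  proof (rule DERIV_nonpos_imp_decreasing_open[OF \<open>T \<ge> 0\<close>])
    show "continuous_on {0..T} (\<lambda>t. V (x t) * exp (c * t))"
      by (intro continuous_intros continuous_on_compose2[OF contV continuous_on_solution[OF sol]]) auto
    fix t assume t: "0 < t" "t < T"
    have "(x has_vector_derivative F (x t)) (at t within {0..T})"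
      using sol t by (auto simp: solves_on_def)
    then have "(x has_vector_derivative F (x t)) (at t)"
      using t by (simp add: at_within_Icc_at)
    then have "(V \<circ> x has_vector_derivative V' (x t) (F (x t))) (at t)"
      by (rule vector_derivative_diff_chain_within)
        (use V has_derivative_at_withinI in blast)
    then have "((\<lambda>t. V (x t)) has_real_derivative V' (x t) (F (x t))) (at t)"
      by (simp add: has_real_derivative_iff_has_vector_derivative o_def)
    then have "((\<lambda>t. V (x t) * exp (c * t)) has_real_derivative
        (V' (x t) (F (x t)) + c * V (x t)) * exp (c * t)) (at t)"
      by (auto intro!: derivative_eq_intros simp: algebra_simps)
    moreover have "(V' (x t) (F (x t)) + c * V (x t)) * exp (c * t) \<le> 0"
      using decr[of t] t by (intro mult_nonpos_nonneg) auto
    ultimately show "\<exists>y. ((\<lambda>t. V (x t) * exp (c * t)) has_real_derivative y) (at t) \<and> y \<le> 0"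
      by blast
  qed
  then show ?thesis by (simp add: exp_minus field_simps)
qed

text \<open>On reaching the sphere of radius \<rho> the solution would have V at least m \<rho>^2.
  But V starts below this level and does not increase as long as the solution stays in the closed
  ball.\<close>

lemma lyapunov_trapping:
  fixes V :: "'a::real_normed_vector \<Rightarrow> real"
  assumes sol: "solves_on F x {0..T}"
    and V: "\<And>p. (V has_derivative V' p) (at p)"
    and decr: "\<And>p. norm p \<le> \<rho> \<Longrightarrow> V' p (F p) \<le> - c * V p"
    and "m \<ge> 0" and lower: "\<And>p. m * (norm p)\<^sup>2 \<le> V p"
    and "c \<ge> 0" and "\<rho> \<ge> 0" and init: "V (x 0) < m * \<rho>\<^sup>2"
    and "t \<in> {0..T}"
  shows "norm (x t) < \<rho>"
proof (rule ccontr)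
  assume "\<not> norm (x t) < \<rho>"
  \<comment> \<open>\<open>\<tau>\<close> below is the first exit time; \<open>V\<close> has not increased up to then.\<close>
  define S where "S = {s\<in>{0..T}. \<rho> \<le> norm (x s)}"
  have "t \<in> S" using \<open>t \<in> {0..T}\<close> \<open>\<not> norm (x t) < \<rho>\<close> by (auto simp: S_def)
  have "closed S"
    unfolding S_def
    by (intro continuous_on_closed_Collect_le continuous_on_const continuous_on_norm
        continuous_on_solution[OF sol]) auto
  define \<tau> where "\<tau> = Inf S"
  have bdd: "bdd_below S" by (auto simp: S_def)
  then have "\<tau> \<in> S"
    unfolding \<tau>_def using \<open>closed S\<close> \<open>t \<in> S\<close> by (intro closed_contains_Inf) auto
  then have \<tau>: "0 \<le> \<tau>" "\<tau> \<le> T" "\<rho> \<le> norm (x \<tau>)" by (auto simp: S_def)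
  have before: "norm (x s) < \<rho>" if "s \<in> {0..<\<tau>}" for s
  proof (rule ccontr)
    assume "\<not> norm (x s) < \<rho>"
    then have "s \<in> S" using that \<tau> by (auto simp: S_def)
    then show False using cInf_lower[OF _ bdd, of s] that by (auto simp: \<tau>_def)
  qed
  have sol\<tau>: "solves_on F x {0..\<tau>}"
    using sol \<tau> by (auto intro: solves_on_subset)
  \<comment> \<open>The decay estimate needs the bound at \<tau> too, and continuity supplies it
    from the times before. If \<tau> = 0 there are no earlier times; then the initial level
    contradicts the lower bound on V.\<close>
  have "norm (x s) \<le> \<rho>" if "s \<in> {0..\<tau>}" for s
  proof (cases "\<tau> = 0")
    case True
    have "V (x 0) < m * (norm (x 0))\<^sup>2"
      using init \<tau> True \<open>m \<ge> 0\<close> \<open>\<rho> \<ge> 0\<close>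
      by (meson less_le_trans mult_left_mono power_mono)
    then show ?thesis using lower[of "x 0"] by simp
  next
    case False
    then have "closure {0..<\<tau>} = {0..\<tau>}" using \<tau> by simp
    have "continuous_on (closure {0..<\<tau>}) (\<lambda>s. norm (x s))"
      using continuous_on_solution[OF sol\<tau>] \<open>closure {0..<\<tau>} = {0..\<tau>}\<close>
      by (auto intro: continuous_on_norm)
    then show ?thesis
      by (rule continuous_le_on_closure)
        (use that before \<open>closure {0..<\<tau>} = {0..\<tau>}\<close> in \<open>auto intro: less_imp_le\<close>)
  qed
  then have "V (x \<tau>) \<le> V (x 0) * exp (- c * \<tau>)"
    using \<tau> by (intro lyapunov_decay[OF sol\<tau> _ V] decr) auto
  also have "\<dots> \<le> V (x 0) * 1"
  proof (rule mult_left_mono)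
    show "exp (- c * \<tau>) \<le> 1" using \<tau> \<open>c \<ge> 0\<close> by simp
    have "0 \<le> m * (norm (x 0))\<^sup>2" using \<open>m \<ge> 0\<close> by simp
    also have "\<dots> \<le> V (x 0)" by (rule lower)
    finally show "0 \<le> V (x 0)" .
  qed
  also have "\<dots> < m * \<rho>\<^sup>2" using init by simp
  also have "\<dots> \<le> m * (norm (x \<tau>))\<^sup>2"
    using \<tau> \<open>m \<ge> 0\<close> \<open>\<rho> \<ge> 0\<close> by (intro mult_left_mono power_mono)
  also have "\<dots> \<le> V (x \<tau>)" by (rule lower)
  finally show False by simp
qed

text \<open>By continuity V is below m \<rho>^2 near 0, which traps solutions in the ball of radius
  \<rho>: this is stability. Inside the ball of radius r, V decays exponentially, and the quadratic
  lower bound passes the decay on to the norm: this is attraction.\<close>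

lemma lyapunov_asymptotically_stable:
  fixes F :: "'a::euclidean_space \<Rightarrow> 'a" and V :: "'a \<Rightarrow> real"
  assumes "F 0 = 0" and "r > 0" and lip: "K-lipschitz_on (cball 0 r) F"
    and V: "\<And>p. (V has_derivative V' p) (at p)"
    and decr: "\<And>p. norm p \<le> r \<Longrightarrow> V' p (F p) \<le> - c * V p" and "c > 0"
    and lower: "\<And>p. m * (norm p)\<^sup>2 \<le> V p" and "m > 0"
    and "V 0 = 0"
  shows "asymptotically_stable F 0"
proof -
  have contV: "isCont V 0"
    using V has_derivative_continuous by blast
  have small: "\<exists>\<delta>>0. \<forall>p\<in>ball 0 \<delta>. V p < m * \<rho>\<^sup>2" if "\<rho> > 0" for \<rho>
  proof -
    have "m * \<rho>\<^sup>2 > 0" using that \<open>m > 0\<close> by simp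
    then have "eventually (\<lambda>p. V p < m * \<rho>\<^sup>2) (at 0)"
      using contV \<open>V 0 = 0\<close> by (intro order_tendstoD) (auto simp: isCont_def)
    then have "eventually (\<lambda>p. V p < m * \<rho>\<^sup>2) (nhds 0)"
      using \<open>V 0 = 0\<close> \<open>m * \<rho>\<^sup>2 > 0\<close> by (simp add: eventually_nhds_conv_at)
    then show ?thesis
      by (auto simp: eventually_nhds_metric dist_commute)
  qed
  \<comment> \<open>\<open>G\<close> is globally Lipschitz because the projection onto a closed convex set is nonexpansive.\<close>
  define G where "G = F \<circ> closest_point (cball 0 r)"
  have ball: "convex (cball 0 r :: 'a set)" "closed (cball 0 r :: 'a set)" "cball 0 r \<noteq> ({} :: 'a set)"
    using \<open>r > 0\<close> by auto
  have "1-lipschitz_on UNIV (closest_point (cball 0 r :: 'a set))"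
    using closest_point_lipschitz[OF ball] by (auto intro!: lipschitz_onI)
  moreover have "K-lipschitz_on (closest_point (cball 0 r) ` UNIV) F"
    using lip closest_point_in_set[OF ball(2,3)] by (auto intro: lipschitz_on_subset)
  ultimately have lipG: "K-lipschitz_on UNIV G"
    unfolding G_def using lipschitz_on_compose by fastforce
  have GF: "G p = F p" if "norm p \<le> r" for p
    using that closest_point_self[of p "cball 0 r"] by (simp add: G_def)
  have "stable_equilibrium F 0"
    unfolding stable_equilibrium_def
  proof (intro conjI allI impI)
    fix \<epsilon> :: real assume "\<epsilon> > 0"
    define \<rho> where "\<rho> = min \<epsilon> r"
    have "\<rho> > 0" "\<rho> \<le> r" "\<rho> \<le> \<epsilon>" using \<open>\<epsilon> > 0\<close> \<open>r > 0\<close> by (auto simp: \<rho>_def)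
    obtain \<delta> where "\<delta> > 0" and \<delta>: "\<And>p. p \<in> ball 0 \<delta> \<Longrightarrow> V p < m * \<rho>\<^sup>2"
      using small[OF \<open>\<rho> > 0\<close>] by blast
    \<comment> \<open>Stated for every field \<open>H\<close> that agrees with F on the ball, so
      that it serves the cut-off field \<open>G\<close> in the existence part and F itself in the
      stability part.\<close>
    have trap: "norm (x t) < \<rho>" if "solves_on H x {0..T}" "x 0 \<in> ball 0 \<delta>" "t \<in> {0..T}"
      "\<And>p. norm p \<le> r \<Longrightarrow> H p = F p" for H x t T
      by (rule lyapunov_trapping[OF that(1) V, of _ c m])
        (use that decr lower \<delta> \<open>\<rho> > 0\<close> \<open>\<rho> \<le> r\<close> \<open>m > 0\<close> \<open>c > 0\<close> in auto)
    have "\<exists>x. solves_on F x {0..} \<and> x 0 = p" if p: "p \<in> ball 0 \<delta>" for p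
    proof -
      obtain x where x: "solves_on G x {0..}" "x 0 = p"
        using lipschitz_global_solution_exists[OF lipG] by blast
      have "norm (x t) \<le> r" if "t \<ge> 0" for t
      proof -
        have "solves_on G x {0..t}" using x(1) by (rule solves_on_subset) auto
        then have "norm (x t) < \<rho>" by (rule trap) (use p x(2) that GF in auto)
        then show ?thesis using \<open>\<rho> \<le> r\<close> by simp
      qed
      then have "solves_on F x {0..}" using x(1) GF by (auto simp: solves_on_def)
      then show ?thesis using x(2) by blast
    qed
    moreover have "x t \<in> ball 0 \<epsilon>"
      if "solves_on F x {0..T}" "x 0 \<in> ball 0 \<delta>" "t \<in> {0..T}" for x t T
      using trap[OF that] \<open>\<rho> \<le> \<epsilon>\<close> by simp
    ultimately show "\<exists>\<delta>>0. \<forall>p\<in>ball 0 \<delta>. (\<exists>x. solves_on F x {0..} \<and> x 0 = p) \<and>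
        (\<forall>T\<ge>0. \<forall>x. solves_on F x {0..T} \<and> x 0 = p \<longrightarrow> (\<forall>t\<in>{0..T}. x t \<in> ball 0 \<epsilon>))"
      using \<open>\<delta> > 0\<close> by blast
  qed fact
  moreover have "attractive_equilibrium F 0"
    unfolding attractive_equilibrium_def
  proof (intro conjI)
    obtain \<delta> where "\<delta> > 0" and \<delta>: "\<And>p. p \<in> ball 0 \<delta> \<Longrightarrow> V p < m * r\<^sup>2"
      using small[OF \<open>r > 0\<close>] by blast
    have "(x \<longlongrightarrow> 0) at_top" if x: "solves_on F x {0..}" "x 0 \<in> ball 0 \<delta>" for x
    proof -
      have decay: "(norm (x t))\<^sup>2 \<le> V (x 0) / m * exp (- c * t)" if "t \<ge> 0" for t
      proof -
        have sol: "solves_on F x {0..t}" using x(1) by (rule solves_on_subset) auto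
        have "norm (x s) < r" if "s \<in> {0..t}" for s
          by (rule lyapunov_trapping[OF sol V decr _ lower])
            (use \<delta> x(2) \<open>r > 0\<close> \<open>m > 0\<close> \<open>c > 0\<close> that in auto)
        then have "V (x t) \<le> V (x 0) * exp (- c * t)"
          using that by (intro lyapunov_decay[OF sol _ V] decr) (auto intro: less_imp_le)
        then have "m * (norm (x t))\<^sup>2 \<le> V (x 0) * exp (- c * t)"
          using lower[of "x t"] by linarith
        then show ?thesis using \<open>m > 0\<close> by (simp add: field_simps)
      qed
      have "((\<lambda>t. exp (- c * t)) \<longlongrightarrow> 0) at_top"
        using \<open>c > 0\<close> by real_asymp
      then have "((\<lambda>t. V (x 0) / m * exp (- c * t)) \<longlongrightarrow> V (x 0) / m * 0) at_top"
        by (rule tendsto_mult_left)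
      then have upper: "((\<lambda>t. V (x 0) / m * exp (- c * t)) \<longlongrightarrow> 0) at_top"
        by (simp only: mult_zero_right)
      have "((\<lambda>t. (norm (x t))\<^sup>2) \<longlongrightarrow> 0) at_top"
      proof (rule tendsto_sandwich[OF _ _ tendsto_const upper])
        show "\<forall>\<^sub>F t in at_top. (norm (x t))\<^sup>2 \<le> V (x 0) / m * exp (- c * t)"
          using decay by (rule eventually_at_top_linorderI)
      qed simp
      then have "((\<lambda>t. sqrt ((norm (x t))\<^sup>2)) \<longlongrightarrow> sqrt 0) at_top"
        by (rule tendsto_real_sqrt)
      then show ?thesis by (simp add: tendsto_norm_zero_iff)
    qed
    then show "\<exists>\<delta>>0. \<forall>x. solves_on F x {0..} \<and> x 0 \<in> ball 0 \<delta> \<longrightarrow> (x \<longlongrightarrow> 0) at_top"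
      using \<open>\<delta> > 0\<close> by blast
  qed fact
  ultimately show ?thesis unfolding asymptotically_stable_def by blast
qed

section \<open>Lipschitz functions on bounded sets\<close>

text \<open>Hiding the constant lets the closure properties below be chained as introduction rules
  without tracking constants.\<close>

definition lipschitzian_on :: "'a::metric_space set \<Rightarrow> ('a \<Rightarrow> 'b::metric_space) \<Rightarrow> bool" where
  "lipschitzian_on S f \<longleftrightarrow> (\<exists>K. K-lipschitz_on S f)"

lemma lipschitzian_on_subset:
  assumes "lipschitzian_on T f" "S \<subseteq> T"
  shows "lipschitzian_on S f"
  using assms unfolding lipschitzian_on_def by (metis lipschitz_on_subset)

lemma lipschitzian_on_const: "lipschitzian_on S (\<lambda>x. c)"
  unfolding lipschitzian_on_def by (blast intro: lipschitz_on_constant)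

lemma lipschitzian_on_id: "lipschitzian_on S (\<lambda>x. x)"
  unfolding lipschitzian_on_def by (blast intro: lipschitz_on_id)

lemma lipschitzian_on_add:
  fixes f g :: "'a::metric_space \<Rightarrow> 'b::real_normed_vector"
  assumes "lipschitzian_on S f" "lipschitzian_on S g"
  shows "lipschitzian_on S (\<lambda>x. f x + g x)"
  using assms unfolding lipschitzian_on_def by (blast intro: lipschitz_on_add)

lemma lipschitzian_on_Pair:
  assumes "lipschitzian_on S f" "lipschitzian_on S g"
  shows "lipschitzian_on S (\<lambda>x. (f x, g x))"
  using assms unfolding lipschitzian_on_def by (blast intro: lipschitz_on_Pair)

lemma lipschitzian_on_compose:
  assumes "lipschitzian_on S f" "lipschitzian_on T g" "f ` S \<subseteq> T"
  shows "lipschitzian_on S (\<lambda>x. g (f x))"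
  using assms unfolding lipschitzian_on_def
  by (metis lipschitz_on_compose2 lipschitz_on_subset)

lemma lipschitzian_on_bounded_linear:
  assumes "bounded_linear h" "lipschitzian_on S f"
  shows "lipschitzian_on S (\<lambda>x. h (f x))"
proof (rule lipschitzian_on_compose[OF assms(2)])
  show "lipschitzian_on UNIV h"
    unfolding lipschitzian_on_def using bounded_linear.lipschitz_boundE[OF assms(1)] by metis
qed simp

lemma bounded_image_lipschitzian_on:
  fixes f :: "'a::metric_space \<Rightarrow> 'b::metric_space"
  assumes "lipschitzian_on S f" "bounded S"
  shows "bounded (f ` S)"
proof (cases "S = {}")
  case False
  then obtain a where "a \<in> S" by blast
  obtain K where K: "K-lipschitz_on S f" using assms by (auto simp: lipschitzian_on_def)
  obtain B where B: "\<And>x. x \<in> S \<Longrightarrow> dist a x \<le> B"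
    using assms(2) bounded_any_center[of S a] by blast
  have "dist (f a) (f x) \<le> K * B" if "x \<in> S" for x
    using lipschitz_onD[OF K \<open>a \<in> S\<close> that] mult_left_mono[OF B[OF that] lipschitz_on_nonneg[OF K]]
    by linarith
  then show ?thesis by (auto simp: bounded_def)
qed simp

text \<open>The product-rule splitting h (f x) (g x - g y) + h (f x - f y) (g y) leaves one
  undifferenced factor in each term. Such a factor is bounded because a Lipschitz function maps a
  bounded set to a bounded set.\<close>

lemma lipschitzian_on_bounded_bilinear:
  fixes f :: "'a::metric_space \<Rightarrow> 'b::real_normed_vector"
    and g :: "'a \<Rightarrow> 'c::real_normed_vector"
    and h :: "'b \<Rightarrow> 'c \<Rightarrow> 'd::real_normed_vector"
  assumes h: "bounded_bilinear h" and fg: "lipschitzian_on S f" "lipschitzian_on S g"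
    and "bounded S"
  shows "lipschitzian_on S (\<lambda>x. h (f x) (g x))"
proof -
  interpret bounded_bilinear h by fact
  obtain N where "N > 0" and N: "\<And>a b. norm (h a b) \<le> norm a * norm b * N"
    using pos_bounded by blast
  obtain A B where "A > 0" and A: "\<And>x. x \<in> S \<Longrightarrow> norm (f x) \<le> A"
    and "B > 0" and B: "\<And>x. x \<in> S \<Longrightarrow> norm (g x) \<le> B"
    using fg[THEN bounded_image_lipschitzian_on, OF \<open>bounded S\<close>]
    by (auto simp: bounded_pos)
  obtain K L where K: "K-lipschitz_on S f" and L: "L-lipschitz_on S g"
    using fg by (auto simp: lipschitzian_on_def)
  have "dist (h (f x) (g x)) (h (f y) (g y)) \<le> (A * L + K * B) * N * dist x y"
    if "x \<in> S" "y \<in> S" for x y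
  proof -
    have "h (f x) (g x) - h (f y) (g y) = h (f x) (g x - g y) + h (f x - f y) (g y)"
      by (simp add: diff_left diff_right)
    then have "dist (h (f x) (g x)) (h (f y) (g y))
        \<le> norm (h (f x) (g x - g y)) + norm (h (f x - f y) (g y))"
      by (simp add: dist_norm norm_triangle_ineq)
    also have "\<dots> \<le> norm (f x) * norm (g x - g y) * N + norm (f x - f y) * norm (g y) * N"
      using N by (intro add_mono)
    also have "\<dots> \<le> A * (L * dist x y) * N + (K * dist x y) * B * N"
      using A B that lipschitz_on_nonneg[OF K] lipschitz_onD[OF K that] lipschitz_onD[OF L that] \<open>N > 0\<close> \<open>A > 0\<close> \<open>B > 0\<close>
      by (intro add_mono mult_right_mono mult_mono) (auto simp: dist_norm intro: order_trans)
    finally show ?thesis by (simp add: algebra_simps)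
  qed
  moreover have "(A * L + K * B) * N \<ge> 0"
    using \<open>A > 0\<close> \<open>B > 0\<close> \<open>N > 0\<close> lipschitz_on_nonneg[OF K] lipschitz_on_nonneg[OF L] by simp
  ultimately show ?thesis
    unfolding lipschitzian_on_def by (blast intro: lipschitz_onI)
qed

section \<open>Regularity of a smooth function with a prescribed Taylor series\<close>

text \<open>The first partial derivatives are themselves differentiable, hence continuous, hence
  bounded on a compact ball; the mean value inequality on this convex ball gives the Lipschitz
  bound.\<close>

lemma smooth_with_taylor_seriesD:
  assumes "smooth_with_taylor_series \<phi> f"
  shows smooth_value: "\<phi> (0, 0) = coeff2 f 0 0"
    and smooth_has_derivative: "\<exists>L. (\<phi> has_derivative L) (at (0, 0))"
    and smooth_lipschitzian: "\<exists>r>0. lipschitzian_on (cball (0, 0) r) \<phi>"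
proof -
  obtain U D where U: "open U" "(0, 0) \<in> U" and D0: "\<And>p. p \<in> U \<Longrightarrow> D 0 0 p = \<phi> p"
    and D: "\<And>i j p. p \<in> U \<Longrightarrow> (D i j has_derivative
      (\<lambda>(h, k). h * D (Suc i) j p + k * D i (Suc j) p)) (at p)"
    and coeff: "\<And>i j. D i j (0, 0) = fact i * fact j * coeff2 f i j"
    using assms unfolding smooth_with_taylor_series_def by metis
  show "\<phi> (0, 0) = coeff2 f 0 0"
    using D0[OF U(2)] coeff[of 0 0] by simp
  have deriv: "(\<phi> has_derivative (\<lambda>(h, k). h * D 1 0 p + k * D 0 1 p)) (at p)" if "p \<in> U" for p
    using has_derivative_transform_within_open[OF D[of p 0 0] U(1) that D0] that by simp
  then show "\<exists>L. (\<phi> has_derivative L) (at (0, 0))"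
    using U(2) by blast
  obtain r where "r > 0" and r: "cball (0, 0) r \<subseteq> U"
    using U open_contains_cball by blast
  have "continuous_on (cball (0, 0) r) (D i j)" for i j
    using D r by (meson continuous_at_imp_continuous_on has_derivative_continuous subsetD)
  then have "bounded (D i j ` cball (0, 0) r)" for i j
    using compact_continuous_image compact_cball compact_imp_bounded by blast
  then have "\<exists>B. \<forall>p\<in>cball (0, 0) r. norm (D i j p) \<le> B" for i j
    unfolding bounded_iff by blast
  then obtain B where B: "\<And>i j p. p \<in> cball (0, 0) r \<Longrightarrow> norm (D i j p) \<le> B i j"
    by metis
  have "norm (\<phi> p - \<phi> q) \<le> (B 1 0 + B 0 1) * norm (p - q)"
    if "p \<in> cball (0, 0) r" "q \<in> cball (0, 0) r" for p q
  proof (rule differentiable_bound[OF _ _ _ that])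
    fix p :: "real \<times> real" assume p: "p \<in> cball (0, 0) r"
    then show "(\<phi> has_derivative (\<lambda>(h, k). h * D 1 0 p + k * D 0 1 p)) (at p within cball (0, 0) r)"
      using deriv r has_derivative_at_withinI by blast
    show "onorm (\<lambda>(h, k). h * D 1 0 p + k * D 0 1 p) \<le> B 1 0 + B 0 1"
    proof (rule onorm_le, clarify)
      fix h k :: real
      have "norm (h * D 1 0 p + k * D 0 1 p) \<le> norm h * norm (D 1 0 p) + norm k * norm (D 0 1 p)"
        by (metis norm_mult norm_triangle_ineq)
      also have "\<dots> \<le> norm (h, k) * B 1 0 + norm (h, k) * B 0 1"
        using B[OF p, of 1 0] B[OF p, of 0 1] norm_fst_le[of h k] norm_snd_le[of k h]
        by (intro add_mono mult_mono) auto
      finally show "norm (h * D 1 0 p + k * D 0 1 p) \<le> (B 1 0 + B 0 1) * norm (h, k)"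
        by (simp add: algebra_simps)
    qed
  qed simp
  moreover have "B 1 0 + B 0 1 \<ge> 0"
    using order_trans[OF norm_ge_zero B[of "(0, 0)" 1 0]]
      order_trans[OF norm_ge_zero B[of "(0, 0)" 0 1]] \<open>r > 0\<close> by simp
  ultimately have "(B 1 0 + B 0 1)-lipschitz_on (cball (0, 0) r) \<phi>"
    by (intro lipschitz_onI) (auto simp: dist_norm)
  then show "\<exists>r>0. lipschitzian_on (cball (0, 0) r) \<phi>"
    using \<open>r > 0\<close> unfolding lipschitzian_on_def by blast
qed

section \<open>The normal form field\<close>

text \<open>The argument \<open>w\<close> of the functions \<phi> j in
  \<open>normal_form_field\<close>, isolated so that these functions can be treated as compositions
  with a quadratic map.\<close>

definition amplitudes :: "real \<times> real \<times> complex \<Rightarrow> real \<times> real" where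
  "amplitudes = (\<lambda>(y1, y2, z). (y1\<^sup>2, Re (z * cnj z)))"

text \<open>Written with projections instead of pattern matching, so that the rules for derivatives
  and Lipschitz functions apply to each component.\<close>

lemma normal_form_field_alt:
  "normal_form_field \<alpha>1 \<alpha>2 \<alpha>3 \<phi> p =
    (fst (snd p),
     (\<alpha>1 + \<phi> 1 (amplitudes p)) * fst p + (\<alpha>2 + \<phi> 2 (amplitudes p)) * fst (snd p),
     (\<i> + of_real \<alpha>3 + of_real (\<phi> 3 (amplitudes p)) + \<i> * of_real (\<phi> 4 (amplitudes p))) * snd (snd p))"
  by (cases p) (simp add: normal_form_field_def amplitudes_def Let_def)

lemma amplitudes_alt:
  "amplitudes p = (fst p * fst p, Re (snd (snd p) * cnj (snd (snd p))))"
  by (cases p) (simp add: amplitudes_def power2_eq_square)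

lemma amplitudes_0 [simp]: "amplitudes (0, 0, 0) = (0, 0)"
  by (simp add: amplitudes_def)

text \<open>Both components are quadratic. Hence composing \<phi> j with this map gives a function
  of zero derivative at the origin.\<close>

lemma amplitudes_has_derivative: "(amplitudes has_derivative (\<lambda>h. (0, 0))) (at (0, 0, 0))"
  unfolding amplitudes_alt[abs_def]
  by (auto intro!: derivative_eq_intros)

lemma norm_amplitudes_le: "norm (amplitudes p) \<le> (norm p)\<^sup>2"
proof (cases p)
  case (fields y1 y2 z)
  have "norm (amplitudes p) \<le> y1\<^sup>2 + (cmod z)\<^sup>2"
    using norm_Pair_le[of "y1\<^sup>2" "(cmod z)\<^sup>2"] unfolding fields
    by (simp add: amplitudes_def complex_mult_cnj cmod_power2)
  also have "\<dots> \<le> (norm p)\<^sup>2" by (simp add: fields norm_Pair)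
  finally show ?thesis .
qed

text \<open>By the product rule a term \<phi> j times a coordinate has derivative 0 at the origin,
  since both factors vanish there. What remains is the constant-coefficient part.\<close>

lemma normal_form_field_has_derivative:
  assumes "\<And>j. j \<in> {1..4} \<Longrightarrow> \<phi> j (0, 0) = 0"
    and "\<And>j. j \<in> {1..4} \<Longrightarrow> \<exists>L. (\<phi> j has_derivative L) (at (0, 0))"
  shows "(normal_form_field \<alpha>1 \<alpha>2 \<alpha>3 \<phi> has_derivative
    (\<lambda>(y1, y2, z). (y2, \<alpha>1 * y1 + \<alpha>2 * y2, (\<i> + of_real \<alpha>3) * z))) (at (0, 0, 0))"
proof -
  have [derivative_intros]:
    "((\<lambda>p. \<phi> j (amplitudes p)) has_derivative (\<lambda>h. 0)) (at (0, 0, 0))" if j: "j \<in> {1..4}" for j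
  proof -
    obtain L where L: "(\<phi> j has_derivative L) (at (0, 0))" using assms(2)[OF j] by blast
    have "((\<lambda>p. \<phi> j (amplitudes p)) has_derivative (\<lambda>h. L (0, 0))) (at (0, 0, 0))"
      using has_derivative_compose[OF amplitudes_has_derivative, of "\<phi> j" L] L by simp
    moreover have "L (0, 0) = 0"
      using linear_0[OF has_derivative_linear[OF L]] by (simp add: zero_prod_def)
    ultimately show ?thesis by simp
  qed
  have [derivative_intros]:
    "((\<lambda>p. complex_of_real (\<phi> j (amplitudes p))) has_derivative (\<lambda>h. 0)) (at (0, 0, 0))"
    if "j \<in> {1..4}" for j
    using \<open>j \<in> {1..4} \<Longrightarrow> ((\<lambda>p. \<phi> j (amplitudes p)) has_derivative (\<lambda>h. 0)) (at (0, 0, 0))\<close> that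
    by (auto intro!: derivative_eq_intros)
  show ?thesis
    unfolding normal_form_field_alt[abs_def]
    by (auto intro!: derivative_eq_intros simp: assms(1) algebra_simps)
qed

text \<open>Multiplication by \<alpha>3 + i acts on (Re z, Im z) as the lower right block of
  \<open>A0\<close>.\<close>

lemma real_coords_linear_part:
  "real_coords ((\<lambda>(y1, y2, z). (y2, \<alpha>1 * y1 + \<alpha>2 * y2, (\<i> + of_real \<alpha>3) * z)) p) =
    A0 \<alpha>1 \<alpha>2 \<alpha>3 *\<^sub>v real_coords p"
proof (cases p)
  case (fields y1 y2 z)
  show ?thesis
    unfolding fields
    by (rule eq_vecI)
      (auto simp: real_coords_def A0_def mat_of_rows_list_def scalar_prod_def
        numeral_eq_Suc less_Suc_eq row_def vec_of_list_index algebra_simps)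
qed

lemma normal_form_field_lipschitzian:
  assumes "bounded S" and "\<And>j. j \<in> {1..4} \<Longrightarrow> lipschitzian_on (amplitudes ` S) (\<phi> j)"
  shows "lipschitzian_on S (normal_form_field \<alpha>1 \<alpha>2 \<alpha>3 \<phi>)"
proof -
  note mult = lipschitzian_on_bounded_bilinear[OF bounded_bilinear_mult _ _ \<open>bounded S\<close>]
  have coords: "lipschitzian_on S (\<lambda>p. fst p)" "lipschitzian_on S (\<lambda>p. fst (snd p))"
    "lipschitzian_on S (\<lambda>p. snd (snd p))"
    by (intro lipschitzian_on_bounded_linear[OF bounded_linear_fst]
        lipschitzian_on_bounded_linear[OF bounded_linear_snd] lipschitzian_on_id)+
  have "lipschitzian_on S amplitudes"
    unfolding amplitudes_alt[abs_def]
    by (intro lipschitzian_on_Pair lipschitzian_on_bounded_linear[OF bounded_linear_Re]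
        lipschitzian_on_bounded_linear[OF bounded_linear_cnj] mult coords)
  then have \<phi>: "lipschitzian_on S (\<lambda>p. \<phi> j (amplitudes p))" if "j \<in> {1..4}" for j
    using lipschitzian_on_compose[OF _ assms(2)[OF that] order_refl] by simp
  show ?thesis
    unfolding normal_form_field_alt[abs_def]
    by (intro lipschitzian_on_Pair lipschitzian_on_add lipschitzian_on_const mult coords \<phi>
        lipschitzian_on_bounded_linear[OF bounded_linear_of_real]) auto
qed

section \<open>The Lyapunov function of the normal form\<close>

text \<open>The left side is the derivative of 2 a y1^2 + y2^2 + (b y1 + y2)^2 along y1' = y2, y2' =
  q, with u1 and u2 as perturbations. Without them the y1 y2 terms cancel and leave -2 a b y1^2 - 2
  b y2^2; half of this pays for the perturbation.\<close>

lemma damped_oscillator_dissipation: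
  fixes a b k \<eta> u1 u2 y1 y2 :: real
  assumes "a > 0" "b > 0" "\<bar>u1\<bar> \<le> \<eta>" "\<bar>u2\<bar> \<le> \<eta>"
    and k: "(4 * b + 8) * \<eta> \<le> k" "k \<le> a * b" "k \<le> b"
    and q: "q = (u1 - a) * y1 + (u2 - b) * y2"
  shows "4 * a * y1 * y2 + 2 * y2 * q + 2 * (b * y1 + y2) * (b * y2 + q) \<le> - k * (y1\<^sup>2 + y2\<^sup>2)"
proof -
  have "\<bar>u1 * y1 + u2 * y2\<bar> \<le> \<bar>u1\<bar> * \<bar>y1\<bar> + \<bar>u2\<bar> * \<bar>y2\<bar>"
    by (metis abs_mult abs_triangle_ineq)
  also have "\<dots> \<le> \<eta> * (\<bar>y1\<bar> + \<bar>y2\<bar>)"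
    using assms(3,4) by (auto simp: distrib_left intro!: add_mono mult_right_mono)
  finally have u: "\<bar>u1 * y1 + u2 * y2\<bar> \<le> \<eta> * (\<bar>y1\<bar> + \<bar>y2\<bar>)" .
  \<comment> \<open>This linear form is the coefficient of u1 y1 + u2 y2 in the derivative. Passing
    from (|y1| + |y2|)^2 to the sum of squares doubles its bound 2 b + 4, whence the constant 4 b +
    8.\<close>
  have "\<bar>2 * b * y1 + 4 * y2\<bar> \<le> 2 * b * \<bar>y1\<bar> + 4 * \<bar>y2\<bar>"
    using abs_triangle_ineq[of "2 * b * y1" "4 * y2"] \<open>b > 0\<close> by (simp add: abs_mult)
  also have "\<dots> \<le> (2 * b + 4) * (\<bar>y1\<bar> + \<bar>y2\<bar>)"
    using \<open>b > 0\<close> by (simp add: algebra_simps)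
  finally have w: "\<bar>2 * b * y1 + 4 * y2\<bar> \<le> (2 * b + 4) * (\<bar>y1\<bar> + \<bar>y2\<bar>)" .
  have "\<eta> \<ge> 0" using assms(3) by linarith
  have "(2 * b * y1 + 4 * y2) * (u1 * y1 + u2 * y2)
      \<le> \<bar>2 * b * y1 + 4 * y2\<bar> * \<bar>u1 * y1 + u2 * y2\<bar>"
    by (metis abs_ge_self abs_mult)
  also have "\<dots> \<le> ((2 * b + 4) * (\<bar>y1\<bar> + \<bar>y2\<bar>)) * (\<eta> * (\<bar>y1\<bar> + \<bar>y2\<bar>))"
    using u w \<open>b > 0\<close> by (intro mult_mono) auto
  also have "\<dots> = (2 * b + 4) * \<eta> * (\<bar>y1\<bar> + \<bar>y2\<bar>)\<^sup>2"
    by (simp add: power2_eq_square mult_ac)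
  also have "\<dots> \<le> (2 * b + 4) * \<eta> * (2 * (y1\<^sup>2 + y2\<^sup>2))"
  proof (rule mult_left_mono)
    show "(\<bar>y1\<bar> + \<bar>y2\<bar>)\<^sup>2 \<le> 2 * (y1\<^sup>2 + y2\<^sup>2)"
      using zero_le_power2[of "\<bar>y1\<bar> - \<bar>y2\<bar>"] by (simp add: power2_sum power2_diff)
    show "0 \<le> (2 * b + 4) * \<eta>" using \<open>\<eta> \<ge> 0\<close> \<open>b > 0\<close> by simp
  qed
  also have "\<dots> = (4 * b + 8) * \<eta> * (y1\<^sup>2 + y2\<^sup>2)" by (simp add: algebra_simps)
  also have "\<dots> \<le> k * (y1\<^sup>2 + y2\<^sup>2)" using k by (intro mult_right_mono) auto
  finally have "(2 * b * y1 + 4 * y2) * (u1 * y1 + u2 * y2) \<le> k * (y1\<^sup>2 + y2\<^sup>2)" .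
  moreover have "k * y1\<^sup>2 \<le> a * b * y1\<^sup>2" "k * y2\<^sup>2 \<le> b * y2\<^sup>2"
    using k by (auto intro: mult_right_mono)
  moreover have "4 * a * y1 * y2 + 2 * y2 * q + 2 * (b * y1 + y2) * (b * y2 + q)
      = (2 * b * y1 + 4 * y2) * (u1 * y1 + u2 * y2) - 2 * (a * b * y1\<^sup>2) - 2 * (b * y2\<^sup>2)"
    by (simp add: q algebra_simps power2_eq_square)
  ultimately show ?thesis by (simp add: algebra_simps)
qed

text \<open>A rotation i z is orthogonal to z, so the frequency term with \<phi> 4 drops out of the
  derivative of |z|^2.\<close>

lemma inner_mult_complex_self: "z \<bullet> (c * z) = Re c * (cmod z)\<^sup>2"
  unfolding inner_complex_def cmod_power2
  by (simp add: algebra_simps power2_eq_square)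

text \<open>The minimum of finitely many radii works because P passes to subsets; this yields one
  ball for the four functions \<phi> j.\<close>

lemma common_cball_radius:
  fixes P :: "'i \<Rightarrow> 'a::metric_space set \<Rightarrow> bool"
  assumes "finite I" and "\<And>i. i \<in> I \<Longrightarrow> \<exists>r>0. P i (cball x r)"
    and mono: "\<And>i S T. P i T \<Longrightarrow> S \<subseteq> T \<Longrightarrow> P i S"
  shows "\<exists>r>0. \<forall>i\<in>I. P i (cball x r)"
  using assms(1,2)
proof (induction I rule: finite_induct)
  case empty
  show ?case by (intro exI[of _ 1]) simp
next
  case (insert i I)
  then obtain r s where "r > 0" "\<forall>i\<in>I. P i (cball x r)" "s > 0" "P i (cball x s)"
    by (metis insertCI)
  moreover have "cball x (min r s) \<subseteq> cball x r" "cball x (min r s) \<subseteq> cball x s" by auto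
  ultimately show ?case
    using mono by (intro exI[of _ "min r s"]) (metis insert_iff min_less_iff_conj)
qed

lemma normal_form_field_asymptotically_stable:
  assumes neg: "\<alpha>1 < 0" "\<alpha>2 < 0" "\<alpha>3 < 0"
    and zero: "\<And>j. j \<in> {1..4} \<Longrightarrow> \<phi> j (0, 0) = 0"
    and lip: "\<And>j. j \<in> {1..4} \<Longrightarrow> \<exists>r>0. lipschitzian_on (cball (0, 0) r) (\<phi> j)"
  shows "asymptotically_stable (normal_form_field \<alpha>1 \<alpha>2 \<alpha>3 \<phi>) (0, 0, 0)"
proof -
  define a b s where "a = - \<alpha>1" and "b = - \<alpha>2" and "s = - \<alpha>3"
  have pos: "a > 0" "b > 0" "s > 0" using neg by (auto simp: a_def b_def s_def)
  define k where "k = b * min a 1"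
  have k: "k > 0" "k \<le> a * b" "k \<le> b" using pos by (auto simp: k_def min_def)
  \<comment> \<open>The first bound meets the smallness condition of the oscillator estimate; the
    second preserves half of the damping of z.\<close>
  define \<eta> where "\<eta> = min (k / (4 * b + 8)) (s / 2)"
  have "\<eta> > 0" using k pos by (simp add: \<eta>_def)
  have "\<eta> \<le> k / (4 * b + 8)" and \<eta>: "\<eta> \<le> s / 2"
    unfolding \<eta>_def by (rule min.cobounded1, rule min.cobounded2)
  then have \<eta>': "(4 * b + 8) * \<eta> \<le> k"
    using pos by (simp add: pos_le_divide_eq mult.commute)
  have "\<exists>r>0. lipschitzian_on (cball (0, 0) r) (\<phi> j) \<and> (\<forall>q\<in>cball (0, 0) r. \<bar>\<phi> j q\<bar> \<le> \<eta>)"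
    if j: "j \<in> {1..4}" for j
  proof -
    obtain r K where "r > 0" and K: "K-lipschitz_on (cball (0, 0) r) (\<phi> j)"
      using lip[OF j] by (auto simp: lipschitzian_on_def)
    \<comment> \<open>As \<phi> j vanishes at the origin, the Lipschitz bound gives at most K
      \<rho>, which is at most \<eta>; \<open>K + 1\<close> guards against division by 0.\<close>
    define \<rho> where "\<rho> = min r (\<eta> / (K + 1))"
    have "K \<ge> 0" using K by (rule lipschitz_on_nonneg)
    then have "\<rho> > 0" using \<open>r > 0\<close> \<open>\<eta> > 0\<close> by (simp add: \<rho>_def)
    have "\<bar>\<phi> j q\<bar> \<le> \<eta>" if q: "q \<in> cball (0, 0) \<rho>" for q
    proof -
      have "q \<in> cball (0, 0) r" using q by (simp add: \<rho>_def)
      then have "\<bar>\<phi> j q\<bar> \<le> K * dist (0, 0) q"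
        using lipschitz_onD[OF K, of "(0, 0)" q] \<open>r > 0\<close> zero[OF j] by (simp add: dist_real_def)
      also have "\<dots> \<le> (K + 1) * (\<eta> / (K + 1))"
        using q \<open>K \<ge> 0\<close> by (intro mult_mono) (auto simp: \<rho>_def)
      finally show ?thesis using \<open>K \<ge> 0\<close> by simp
    qed
    moreover have "lipschitzian_on (cball (0, 0) \<rho>) (\<phi> j)"
    proof (rule lipschitzian_on_subset)
      show "lipschitzian_on (cball (0, 0) r) (\<phi> j)" using K by (auto simp: lipschitzian_on_def)
      show "cball (0, 0) \<rho> \<subseteq> cball (0 :: real, 0 :: real) r" by (auto simp: \<rho>_def)
    qed
    ultimately show ?thesis using \<open>\<rho> > 0\<close> by blast
  qed
  moreover have "lipschitzian_on S (\<phi> j) \<and> (\<forall>q\<in>S. \<bar>\<phi> j q\<bar> \<le> \<eta>)"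
    if "lipschitzian_on T (\<phi> j) \<and> (\<forall>q\<in>T. \<bar>\<phi> j q\<bar> \<le> \<eta>)" "S \<subseteq> T" for j S T
    using that lipschitzian_on_subset by blast
  ultimately have "\<exists>\<rho>>0. \<forall>j\<in>{1..4}.
      lipschitzian_on (cball (0, 0) \<rho>) (\<phi> j) \<and> (\<forall>q\<in>cball (0, 0) \<rho>. \<bar>\<phi> j q\<bar> \<le> \<eta>)"
    by (intro common_cball_radius[where P = "\<lambda>j S. lipschitzian_on S (\<phi> j) \<and> (\<forall>q\<in>S. \<bar>\<phi> j q\<bar> \<le> \<eta>)"])
      blast+
  then obtain \<rho> where "\<rho> > 0"
    and \<rho>: "\<And>j. j \<in> {1..4} \<Longrightarrow> lipschitzian_on (cball (0, 0) \<rho>) (\<phi> j)"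
      "\<And>j q. j \<in> {1..4} \<Longrightarrow> q \<in> cball (0, 0) \<rho> \<Longrightarrow> \<bar>\<phi> j q\<bar> \<le> \<eta>"
    by blast
  \<comment> \<open>With radius at most 1, the squared norm that bounds the amplitudes is at most
    the norm, hence at most \<rho>.\<close>
  define r where "r = min 1 \<rho>"
  have "r > 0" "r \<le> 1" "r \<le> \<rho>" using \<open>\<rho> > 0\<close> by (auto simp: r_def)
  have near: "amplitudes p \<in> cball (0, 0) \<rho>" if "norm p \<le> r" for p
  proof -
    have "(norm p)\<^sup>2 \<le> norm p"
      using that \<open>r \<le> 1\<close> by (simp add: power2_eq_square mult_left_le)
    then show ?thesis
      using norm_amplitudes_le[of p] that \<open>r \<le> \<rho>\<close> by (simp add: zero_prod_def[symmetric])
  qed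
  let ?F = "normal_form_field \<alpha>1 \<alpha>2 \<alpha>3 \<phi>"
  have "lipschitzian_on (cball 0 r) ?F"
  proof (rule normal_form_field_lipschitzian)
    fix j :: nat assume "j \<in> {1..4}"
    moreover have "amplitudes ` cball 0 r \<subseteq> cball (0, 0) \<rho>" using near by auto
    ultimately show "lipschitzian_on (amplitudes ` cball 0 r) (\<phi> j)"
      using \<rho>(1) by (blast intro: lipschitzian_on_subset)
  qed simp
  then obtain K where K: "K-lipschitz_on (cball 0 r) ?F" by (auto simp: lipschitzian_on_def)
  \<comment> \<open>The energy a y1^2 + y2^2 alone has derivative -2 b y2^2 along the linear flow,
    which does not control y1; adding a y1^2 + (b y1 + y2)^2 produces the missing damping.\<close>
  define V :: "real \<times> real \<times> complex \<Rightarrow> real" where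
    "V p = 2 * a * (fst p)\<^sup>2 + (fst (snd p))\<^sup>2 + (b * fst p + fst (snd p))\<^sup>2
      + snd (snd p) \<bullet> snd (snd p)" for p
  define V' :: "real \<times> real \<times> complex \<Rightarrow> real \<times> real \<times> complex \<Rightarrow> real" where
    "V' p h = 4 * a * fst p * fst h + 2 * fst (snd p) * fst (snd h)
      + 2 * (b * fst p + fst (snd p)) * (b * fst h + fst (snd h))
      + 2 * (snd (snd p) \<bullet> snd (snd h))" for p h
  \<comment> \<open>Chosen so that V is at most M (y1^2 + y2^2) + |z|^2, which turns the dissipation
    into the decay rate \<open>min (k / M) s\<close>.\<close>
  define M where "M = 2 * a + 2 * b\<^sup>2 + 3"
  have "M > 0" using pos by (simp add: M_def add_pos_nonneg)
  have V: "(V has_derivative V' p) (at p)" for p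
    unfolding V_def[abs_def] V'_def[abs_def]
    by (auto intro!: derivative_eq_intros simp: inner_commute algebra_simps)
  have lower: "min (2 * a) 1 * (norm p)\<^sup>2 \<le> V p" for p
  proof (cases p)
    case (fields y1 y2 z)
    have "min (2 * a) 1 * y1\<^sup>2 \<le> 2 * a * y1\<^sup>2" "min (2 * a) 1 * y2\<^sup>2 \<le> 1 * y2\<^sup>2"
      "min (2 * a) 1 * (cmod z)\<^sup>2 \<le> 1 * (cmod z)\<^sup>2" "0 \<le> (b * y1 + y2)\<^sup>2"
      by (intro mult_right_mono; simp)+ simp
    moreover have "(norm p)\<^sup>2 = y1\<^sup>2 + y2\<^sup>2 + (cmod z)\<^sup>2"
      by (simp add: fields norm_Pair)
    moreover have "V p = 2 * a * y1\<^sup>2 + y2\<^sup>2 + (b * y1 + y2)\<^sup>2 + (cmod z)\<^sup>2"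
      by (simp add: fields V_def power2_norm_eq_inner)
    ultimately show ?thesis by (simp only: distrib_left)
  qed
  have decr: "V' p (?F p) \<le> - min (k / M) s * V p" if p: "norm p \<le> r" for p
  proof (cases p)
    case (fields y1 y2 z)
    define u where "u j = \<phi> j (amplitudes p)" for j
    have u: "\<bar>u j\<bar> \<le> \<eta>" if "j \<in> {1..4}" for j
      unfolding u_def using \<rho>(2)[OF that near[OF p]] .
    define q where "q = (u 1 - a) * y1 + (u 2 - b) * y2"
    have "snd (snd p) \<bullet> snd (snd (?F p)) = (u 3 - s) * (cmod z)\<^sup>2"
      by (simp add: normal_form_field_alt inner_mult_complex_self fields u_def s_def)
    then have "V' p (?F p) = (4 * a * y1 * y2 + 2 * y2 * q + 2 * (b * y1 + y2) * (b * y2 + q))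
        + 2 * ((u 3 - s) * (cmod z)\<^sup>2)"
      unfolding V'_def
      by (simp add: normal_form_field_alt fields q_def u_def a_def b_def add.commute)
    also have "\<dots> \<le> - k * (y1\<^sup>2 + y2\<^sup>2) + 2 * (- (s / 2) * (cmod z)\<^sup>2)"
    proof (intro add_mono mult_left_mono mult_right_mono)
      show "4 * a * y1 * y2 + 2 * y2 * q + 2 * (b * y1 + y2) * (b * y2 + q)
          \<le> - k * (y1\<^sup>2 + y2\<^sup>2)"
        by (rule damped_oscillator_dissipation[OF pos(1,2) u[of 1] u[of 2] \<eta>' k(2,3) q_def]) auto
      show "u 3 - s \<le> - (s / 2)" using u[of 3] \<eta> by auto
    qed auto
    also have "\<dots> \<le> - min (k / M) s * (M * (y1\<^sup>2 + y2\<^sup>2)) - min (k / M) s * (cmod z)\<^sup>2"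
    proof -
      have "min (k / M) s * (M * (y1\<^sup>2 + y2\<^sup>2)) \<le> k / M * (M * (y1\<^sup>2 + y2\<^sup>2))"
        using \<open>M > 0\<close> by (intro mult_right_mono) auto
      moreover have "min (k / M) s * (cmod z)\<^sup>2 \<le> s * (cmod z)\<^sup>2"
        by (intro mult_right_mono) auto
      ultimately show ?thesis using \<open>M > 0\<close> by simp
    qed
    also have "\<dots> \<le> - min (k / M) s * V p"
    proof -
      have "(b * y1 + y2)\<^sup>2 \<le> 2 * b\<^sup>2 * y1\<^sup>2 + 2 * y2\<^sup>2"
        using zero_le_power2[of "b * y1 - y2"] unfolding power2_sum power2_diff
        by (simp add: power_mult_distrib)
      moreover have "0 \<le> a * y2\<^sup>2" "0 \<le> b\<^sup>2 * y2\<^sup>2" "0 \<le> y1\<^sup>2"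
        using pos by auto
      moreover have "V p = 2 * a * y1\<^sup>2 + y2\<^sup>2 + (b * y1 + y2)\<^sup>2 + (cmod z)\<^sup>2"
        by (simp add: fields V_def power2_norm_eq_inner)
      moreover have "M * (y1\<^sup>2 + y2\<^sup>2) = 2 * a * y1\<^sup>2 + 2 * (a * y2\<^sup>2)
          + 2 * b\<^sup>2 * y1\<^sup>2 + 2 * (b\<^sup>2 * y2\<^sup>2) + 3 * y1\<^sup>2 + 3 * y2\<^sup>2"
        by (simp add: M_def algebra_simps)
      ultimately have "V p \<le> M * (y1\<^sup>2 + y2\<^sup>2) + (cmod z)\<^sup>2" by linarith
      then have "min (k / M) s * V p \<le> min (k / M) s * (M * (y1\<^sup>2 + y2\<^sup>2) + (cmod z)\<^sup>2)"
        using k pos \<open>M > 0\<close> by (intro mult_left_mono) auto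
      then show ?thesis by (simp add: distrib_left)
    qed
    finally show ?thesis .
  qed
  have "asymptotically_stable ?F 0"
    by (rule lyapunov_asymptotically_stable[OF _ \<open>r > 0\<close> K V decr _ lower])
      (use k pos \<open>M > 0\<close> in \<open>auto simp: normal_form_field_def V_def zero_prod_def\<close>)
  then show ?thesis by (simp add: zero_prod_def)
qed

theorem mainTheorem2:
  fixes N :: "(real \<times> real \<times> real) set" and \<alpha>1 \<alpha>2 \<alpha>3 :: real
  assumes "(0, 0, 0) \<in> interior N" and "(\<alpha>1, \<alpha>2, \<alpha>3) \<in> N"
  shows "char_poly (A0_complex \<alpha>1 \<alpha>2 \<alpha>3) =
           (\<Prod>l\<leftarrow>[lambda1 \<alpha>1 \<alpha>2, lambda2 \<alpha>1 \<alpha>2, lambda3 \<alpha>3, lambda4 \<alpha>3]. [:-l, 1:])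
       \<and> {l. eigenvalue (A0_complex \<alpha>1 \<alpha>2 \<alpha>3) l} =
           {lambda1 \<alpha>1 \<alpha>2, lambda2 \<alpha>1 \<alpha>2, lambda3 \<alpha>3, lambda4 \<alpha>3}
       \<and> ((\<forall>l. eigenvalue (A0_complex \<alpha>1 \<alpha>2 \<alpha>3) l \<longrightarrow> Re l < 0) \<longleftrightarrow>
            \<alpha>1 < 0 \<and> \<alpha>2 < 0 \<and> \<alpha>3 < 0)
       \<and> (\<forall>(f :: nat \<Rightarrow> real fps fps) (\<phi> :: nat \<Rightarrow> real \<times> real \<Rightarrow> real).
            (\<forall>j\<in>{1..4}. coeff2 (f j) 0 0 = 0 \<and> smooth_with_taylor_series (\<phi> j) (f j)) \<longrightarrow>
              (\<exists>L. (normal_form_field \<alpha>1 \<alpha>2 \<alpha>3 \<phi> has_derivative L) (at (0, 0, 0)) \<and>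
                 (\<forall>p. real_coords (L p) = A0 \<alpha>1 \<alpha>2 \<alpha>3 *\<^sub>v real_coords p)) \<and>
              (\<alpha>1 < 0 \<and> \<alpha>2 < 0 \<and> \<alpha>3 < 0 \<longrightarrow>
                 asymptotically_stable (normal_form_field \<alpha>1 \<alpha>2 \<alpha>3 \<phi>) (0, 0, 0)))"
proof (intro conjI allI impI)
  show "char_poly (A0_complex \<alpha>1 \<alpha>2 \<alpha>3) =
      (\<Prod>l\<leftarrow>[lambda1 \<alpha>1 \<alpha>2, lambda2 \<alpha>1 \<alpha>2, lambda3 \<alpha>3, lambda4 \<alpha>3]. [:-l, 1:])"
    by (rule char_poly_A0_complex_factored)
  show "{l. eigenvalue (A0_complex \<alpha>1 \<alpha>2 \<alpha>3) l} =
      {lambda1 \<alpha>1 \<alpha>2, lambda2 \<alpha>1 \<alpha>2, lambda3 \<alpha>3, lambda4 \<alpha>3}"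
    unfolding eigenvalue_A0_complex_iff by (rule Collect_mem_eq)
  have "Re (lambda3 \<alpha>3) = \<alpha>3" "Re (lambda4 \<alpha>3) = \<alpha>3"
    by (simp_all add: lambda3_def lambda4_def)
  then show "(\<forall>l. eigenvalue (A0_complex \<alpha>1 \<alpha>2 \<alpha>3) l \<longrightarrow> Re l < 0) \<longleftrightarrow>
      \<alpha>1 < 0 \<and> \<alpha>2 < 0 \<and> \<alpha>3 < 0"
    using Re_lambda12_neg_iff[of \<alpha>1 \<alpha>2] unfolding eigenvalue_A0_complex_iff by auto
next
  fix f :: "nat \<Rightarrow> real fps fps" and \<phi> :: "nat \<Rightarrow> real \<times> real \<Rightarrow> real"
  assume "\<forall>j\<in>{1..4}. coeff2 (f j) 0 0 = 0 \<and> smooth_with_taylor_series (\<phi> j) (f j)"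
  then have coeff: "coeff2 (f j) 0 0 = 0" and smooth: "smooth_with_taylor_series (\<phi> j) (f j)"
    if "j \<in> {1..4}" for j
    using that by blast+
  have zero: "\<phi> j (0, 0) = 0" if "j \<in> {1..4}" for j
    using smooth_value[OF smooth[OF that]] coeff[OF that] by simp
  \<comment> \<open>The witness is the linear part in the coordinates (y1, y2, z); passing to Re z
    and Im z makes it multiplication by \<open>A0\<close>.\<close>
  show "\<exists>L. (normal_form_field \<alpha>1 \<alpha>2 \<alpha>3 \<phi> has_derivative L) (at (0, 0, 0)) \<and>
      (\<forall>p. real_coords (L p) = A0 \<alpha>1 \<alpha>2 \<alpha>3 *\<^sub>v real_coords p)"
    using normal_form_field_has_derivative[where \<phi> = \<phi>, OF zero smooth_has_derivative[OF smooth]]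
      real_coords_linear_part by blast
  show "asymptotically_stable (normal_form_field \<alpha>1 \<alpha>2 \<alpha>3 \<phi>) (0, 0, 0)"
    if "\<alpha>1 < 0 \<and> \<alpha>2 < 0 \<and> \<alpha>3 < 0"
    using that normal_form_field_asymptotically_stable[where \<phi> = \<phi>, OF _ _ _ zero smooth_lipschitzian[OF smooth]]
    by blast
qed

end
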